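(* Let $\{X_n,n\ge 1\}$ be a sequence of random variables. Suppose that $1<p<\infty$ and $\sum_{n=1}^{\infty}\|X_n\|_p<\infty$. Then for any $1<q\leq p$, $$\sum_{n=1}^{\infty}E\left[\left|\frac{S_n}{n}\right|^q\right]<\infty ;$$ in particular, $\frac{S_n}{n}$ converges completely to $0$.
   Context: All random variables are real-valued and defined on a common probability space $(\Omega,\mathcal{F},P)$; no independence is assumed. $E$ denotes expectation, $\|X\|_p=(E[|X|^p])^{1/p}$, and $S_n=\sum_{k=1}^n X_k$ for $n\ge 1$. A sequence of random variables $\{Y_n,n\ge1\}$ is said to converge completely to a random variable $Y$ if for every $\varepsilon>0$, $\sum_{n=1}^{\infty}P\{|Y_n-Y|\geq\varepsilon\}<\infty$. *)

theory Defs
  imports "HOL-Probability.Probability"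
begin

text \<open>
  Sequences indexed by \<open>n \<ge> 1\<close> are functions on \<^typ>\<open>nat\<close> whose value at \<open>0\<close> is never used;
  infinite sums over \<open>n \<ge> 1\<close> are written with \<^const>\<open>Suc\<close>.
  Moments are taken in \<^typ>\<open>ennreal\<close>, so that a divergent expectation is \<open>\<infinity>\<close> and not \<open>0\<close>.
\<close>

text \<open>There is no real power on \<^typ>\<open>ennreal\<close>, hence the case distinction; it assumes \<open>p > 0\<close>.\<close>
definition Lp_norm :: "'a measure \<Rightarrow> real \<Rightarrow> ('a \<Rightarrow> real) \<Rightarrow> ennreal" where
  "Lp_norm M p X =
     (let m = (\<integral>\<^sup>+ \<omega>. ennreal (\<bar>X \<omega>\<bar> powr p) \<partial>M)
      in if m = \<infinity> then \<infinity> else ennreal (enn2real m powr (1 / p)))"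

definition partial_sum :: "(nat \<Rightarrow> 'a \<Rightarrow> real) \<Rightarrow> nat \<Rightarrow> 'a \<Rightarrow> real" where
  "partial_sum X n \<omega> = (\<Sum>k = 1..n. X k \<omega>)"

text \<open>
  Measurability is part of the definition because \<^const>\<open>emeasure\<close> is \<open>0\<close> on non-measurable sets.
\<close>
definition converges_completely ::
    "'a measure \<Rightarrow> (nat \<Rightarrow> 'a \<Rightarrow> real) \<Rightarrow> ('a \<Rightarrow> real) \<Rightarrow> bool" where
  "converges_completely M Y Z \<longleftrightarrow>
     (\<forall>n\<ge>1. Y n \<in> borel_measurable M) \<and> Z \<in> borel_measurable M \<and>
     (\<forall>\<epsilon>>0. (\<Sum>n. emeasure M {\<omega> \<in> space M. \<bar>Y (Suc n) \<omega> - Z \<omega>\<bar> \<ge> \<epsilon>}) < \<infinity>)"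

end

theory Submission
  imports Defs
begin

text \<open>
  Choose \<open>b k > 0\<close> with \<open>\<parallel>X k\<parallel>\<^sub>p \<le> b k\<close> and \<open>B = (\<Sum>k. b k) < \<infinity>\<close>. Jensen's inequality with weights
  proportional to \<open>b k\<close>, applied to the normalised variables \<open>X k / b k\<close>, bounds \<open>E \<bar>S n\<bar>\<^sup>q\<close> by
  \<open>2 * B\<^sup>q\<close> uniformly in \<open>n\<close>. Hence \<open>E \<bar>S n / n\<bar>\<^sup>q\<close> is dominated by a multiple of \<open>n powr -q\<close>, which is
  summable because \<open>q > 1\<close>; complete convergence follows by Markov's inequality.
\<close>

text \<open>
  Truncating from below at \<open>1\<close> keeps Jensen's inequality inside \<open>{0<..}\<close>, where \<open>powr_convex\<close> applies,
  and simultaneously lets the exponent grow from \<open>q\<close> to \<open>p\<close>.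
\<close>
lemma abs_sum_powr_le:
  fixes x b :: "'i \<Rightarrow> real"
  assumes I: "finite I" "I \<noteq> {}" and b: "\<And>i. i \<in> I \<Longrightarrow> b i > 0" and q: "1 \<le> q" "q \<le> p"
  shows "\<bar>\<Sum>i\<in>I. x i\<bar> powr q
           \<le> sum b I powr q * (\<Sum>i\<in>I. b i / sum b I * (1 + \<bar>x i\<bar> powr p / b i powr p))"
proof -
  define B where "B = sum b I"
  have B: "B > 0"
    unfolding B_def using I b by (intro sum_pos) auto
  define y where "y i = max 1 (\<bar>x i\<bar> / b i)" for i
  have "\<bar>\<Sum>i\<in>I. x i\<bar> \<le> (\<Sum>i\<in>I. \<bar>x i\<bar>)"
    by (rule sum_abs)
  also have "\<dots> \<le> (\<Sum>i\<in>I. b i * y i)"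
  proof (rule sum_mono)
    fix i assume "i \<in> I"
    then have "b i > 0" by (rule b)
    moreover have "\<bar>x i\<bar> / b i \<le> y i" by (simp add: y_def)
    ultimately show "\<bar>x i\<bar> \<le> b i * y i" by (simp add: pos_divide_le_eq mult.commute)
  qed
  \<comment> \<open>Pulling out \<open>B\<close> leaves a convex combination: the weights
    \<open>b i / B\<close> are positive and sum to 1.\<close>
  also have "\<dots> = B * (\<Sum>i\<in>I. b i / B * y i)"
    using B by (simp add: sum_distrib_left)
  finally have "\<bar>\<Sum>i\<in>I. x i\<bar> powr q \<le> (B * (\<Sum>i\<in>I. b i / B * y i)) powr q"
    using q by (intro powr_mono2) auto
  also have "\<dots> = B powr q * (\<Sum>i\<in>I. b i / B * y i) powr q"
    using B b by (intro powr_mult)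
  also have "(\<Sum>i\<in>I. b i / B * y i) powr q \<le> (\<Sum>i\<in>I. b i / B * y i powr q)"
    using convex_on_sum[OF I powr_convex[OF q(1)], of "\<lambda>i. b i / B" y] B b
    by (auto simp: B_def y_def less_imp_le simp flip: sum_divide_distrib)
  also have "\<dots> \<le> (\<Sum>i\<in>I. b i / B * (1 + \<bar>x i\<bar> powr p / b i powr p))"
  proof (intro sum_mono mult_left_mono)
    fix i assume i: "i \<in> I"
    have "y i powr q \<le> y i powr p"
      using q by (intro powr_mono) (auto simp: y_def)
    \<comment> \<open>The maximum is one of its two arguments, so \<open>y i powr p\<close> equals
      one summand on the right while the other is nonnegative.\<close>
    also have "\<dots> \<le> 1 + (\<bar>x i\<bar> / b i) powr p"
      by (auto simp: y_def max_def)
    also have "(\<bar>x i\<bar> / b i) powr p = \<bar>x i\<bar> powr p / b i powr p"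
      using b[OF i] by (simp add: powr_divide)
    finally show "y i powr q \<le> 1 + \<bar>x i\<bar> powr p / b i powr p" .
    show "0 \<le> b i / B" using b[OF i] B by simp
  qed
  finally show ?thesis
    by (simp add: B_def mult_left_mono)
qed

text \<open>Integrate the pointwise bound \<open>abs_sum_powr_le\<close>: each bracket has
  expectation at most 1 + 1, since the total mass is 1 and the \<open>p\<close>-th moment of
  \<open>X i\<close> is at most \<open>b i powr p\<close>. The weights sum to 1, so the constant 2
  depends neither on \<open>I\<close> nor on \<open>q\<close>. Only linearity is used, hence no
  independence.\<close>

lemma (in prob_space) nn_integral_abs_sum_powr_le:
  fixes X :: "'i \<Rightarrow> 'a \<Rightarrow> real"
  assumes I: "finite I" "I \<noteq> {}" and b: "\<And>i. i \<in> I \<Longrightarrow> b i > 0" and q: "1 \<le> q" "q \<le> p"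
    and meas: "\<And>i. i \<in> I \<Longrightarrow> X i \<in> borel_measurable M"
    and moment: "\<And>i. i \<in> I \<Longrightarrow> (\<integral>\<^sup>+ \<omega>. ennreal (\<bar>X i \<omega>\<bar> powr p) \<partial>M) \<le> ennreal (b i powr p)"
  shows "(\<integral>\<^sup>+ \<omega>. ennreal (\<bar>\<Sum>i\<in>I. X i \<omega>\<bar> powr q) \<partial>M) \<le> ennreal (2 * sum b I powr q)"
proof -
  define B where "B = sum b I"
  have B: "B > 0"
    unfolding B_def using I b by (intro sum_pos) auto
  have term_le: "(\<integral>\<^sup>+ \<omega>. ennreal (b i / B * (1 + \<bar>X i \<omega>\<bar> powr p / b i powr p)) \<partial>M)
                   \<le> ennreal (b i / B * 2)" if i: "i \<in> I" for i
  proof -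
    note [measurable] = meas[OF i]
    have "(\<integral>\<^sup>+ \<omega>. ennreal (b i / B * (1 + \<bar>X i \<omega>\<bar> powr p / b i powr p)) \<partial>M)
        = (\<integral>\<^sup>+ \<omega>. ennreal (b i / B) + ennreal (b i / B / b i powr p) * ennreal (\<bar>X i \<omega>\<bar> powr p) \<partial>M)"
      using b[OF i] B by (intro nn_integral_cong)
        (simp add: algebra_simps flip: ennreal_plus ennreal_mult)
    also have "\<dots> = ennreal (b i / B)
        + ennreal (b i / B / b i powr p) * (\<integral>\<^sup>+ \<omega>. ennreal (\<bar>X i \<omega>\<bar> powr p) \<partial>M)"
      by (simp add: nn_integral_add nn_integral_cmult emeasure_space_1)
    also have "\<dots> \<le> ennreal (b i / B) + ennreal (b i / B / b i powr p) * ennreal (b i powr p)"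
      by (intro add_left_mono mult_left_mono moment[OF i]) auto
    also have "\<dots> = ennreal (b i / B * 2)"
      using b[OF i] B by (simp flip: ennreal_plus ennreal_mult)
    finally show ?thesis .
  qed
  have "(\<integral>\<^sup>+ \<omega>. ennreal (\<bar>\<Sum>i\<in>I. X i \<omega>\<bar> powr q) \<partial>M)
      \<le> (\<integral>\<^sup>+ \<omega>. ennreal (B powr q)
            * (\<Sum>i\<in>I. ennreal (b i / B * (1 + \<bar>X i \<omega>\<bar> powr p / b i powr p))) \<partial>M)"
  proof (intro nn_integral_mono)
    fix \<omega>
    have "(\<Sum>i\<in>I. ennreal (b i / B * (1 + \<bar>X i \<omega>\<bar> powr p / b i powr p)))
        = ennreal (\<Sum>i\<in>I. b i / B * (1 + \<bar>X i \<omega>\<bar> powr p / b i powr p))"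
      using b B by (intro sum_ennreal) (simp add: less_imp_le)
    then show "ennreal (\<bar>\<Sum>i\<in>I. X i \<omega>\<bar> powr q) \<le> ennreal (B powr q)
            * (\<Sum>i\<in>I. ennreal (b i / B * (1 + \<bar>X i \<omega>\<bar> powr p / b i powr p)))"
      using abs_sum_powr_le[OF I b q, where x = "\<lambda>i. X i \<omega>"]
      by (simp add: B_def ennreal_leI flip: ennreal_mult')
  qed
  also have "\<dots> = ennreal (B powr q)
      * (\<Sum>i\<in>I. \<integral>\<^sup>+ \<omega>. ennreal (b i / B * (1 + \<bar>X i \<omega>\<bar> powr p / b i powr p)) \<partial>M)"
    using meas by (subst nn_integral_cmult) (auto simp: nn_integral_sum)
  also have "\<dots> \<le> ennreal (B powr q) * (\<Sum>i\<in>I. ennreal (b i / B * 2))"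
    by (intro mult_left_mono sum_mono term_le) auto
  also have "(\<Sum>i\<in>I. ennreal (b i / B * 2)) = ennreal (\<Sum>i\<in>I. b i / B * 2)"
    using b B by (intro sum_ennreal) (simp add: less_imp_le)
  also have "(\<Sum>i\<in>I. b i / B * 2) = 2"
    using B by (simp add: B_def flip: sum_distrib_right sum_divide_distrib)
  finally show ?thesis
    by (simp add: B_def mult.commute ennreal_mult')
qed

text \<open>Finiteness excludes the infinite branch of \<open>Lp_norm\<close>; in the other one the
  exponents \<open>1 / p\<close> and \<open>p\<close> cancel. This turns norm bounds into moment
  bounds.\<close>

lemma nn_integral_powr_eq_Lp_norm:
  assumes "Lp_norm M p X < \<infinity>" "p > 0"
  shows "(\<integral>\<^sup>+ \<omega>. ennreal (\<bar>X \<omega>\<bar> powr p) \<partial>M) = ennreal (enn2real (Lp_norm M p X) powr p)"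
proof (cases "\<integral>\<^sup>+ \<omega>. ennreal (\<bar>X \<omega>\<bar> powr p) \<partial>M" rule: ennreal_cases)
  case (real r)
  then show ?thesis
    using assms(2) by (simp add: Lp_norm_def powr_powr)
next
  case top
  then show ?thesis
    using assms(1) by (simp add: Lp_norm_def)
qed

text \<open>Markov's inequality bounds the n-th tail probability by the n-th moment times
  \<open>1 / \<epsilon> powr p\<close>, a factor free of n, so the tails are summable with the
  moments.\<close>

lemma converges_completely_zeroI:
  assumes meas: "\<And>n. n \<ge> 1 \<Longrightarrow> Y n \<in> borel_measurable M" and p: "p > 0"
    and fin: "(\<Sum>n. \<integral>\<^sup>+ \<omega>. ennreal (\<bar>Y (Suc n) \<omega>\<bar> powr p) \<partial>M) < \<infinity>"
  shows "converges_completely M Y (\<lambda>_. 0)"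
  unfolding converges_completely_def
proof (intro conjI allI impI)
  fix \<epsilon> :: real assume \<epsilon>: "\<epsilon> > 0"
  let ?E = "\<lambda>n. \<integral>\<^sup>+ \<omega>. ennreal (\<bar>Y (Suc n) \<omega>\<bar> powr p) \<partial>M"
  have "emeasure M {\<omega> \<in> space M. \<bar>Y (Suc n) \<omega> - 0\<bar> \<ge> \<epsilon>} \<le> ennreal (1 / \<epsilon> powr p) * ?E n" for n
  proof -
    note [measurable] = meas[of "Suc n", simplified]
    \<comment> \<open>For \<open>p > 0\<close> the power is monotone, so the event can be put in the
      normalised form "at least 1" on which Markov's inequality is stated.\<close>
    have "{\<omega> \<in> space M. \<bar>Y (Suc n) \<omega> - 0\<bar> \<ge> \<epsilon>}
        \<subseteq> {\<omega> \<in> space M. 1 \<le> ennreal (1 / \<epsilon> powr p) * ennreal (\<bar>Y (Suc n) \<omega>\<bar> powr p)}"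
      using \<epsilon> p by (auto simp: powr_mono2 simp flip: ennreal_mult)
    then have "emeasure M {\<omega> \<in> space M. \<bar>Y (Suc n) \<omega> - 0\<bar> \<ge> \<epsilon>}
        \<le> emeasure M {\<omega> \<in> space M. 1 \<le> ennreal (1 / \<epsilon> powr p) * ennreal (\<bar>Y (Suc n) \<omega>\<bar> powr p)}"
      by (rule emeasure_mono) measurable
    also have "\<dots> \<le> ennreal (1 / \<epsilon> powr p)
        * (\<integral>\<^sup>+ \<omega>. ennreal (\<bar>Y (Suc n) \<omega>\<bar> powr p) * indicator (space M) \<omega> \<partial>M)"
      by (rule nn_integral_Markov_inequality) auto
    also have "\<dots> = ennreal (1 / \<epsilon> powr p) * ?E n"
      by (auto intro!: arg_cong2[where f = "(*)"] nn_integral_cong)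
    finally show ?thesis .
  qed
  then have "(\<Sum>n. emeasure M {\<omega> \<in> space M. \<bar>Y (Suc n) \<omega> - 0\<bar> \<ge> \<epsilon>})
      \<le> (\<Sum>n. ennreal (1 / \<epsilon> powr p) * ?E n)"
    by (intro suminf_le) auto
  also have "\<dots> < \<infinity>"
    using fin by (simp add: ennreal_mult_less_top)
  finally show "(\<Sum>n. emeasure M {\<omega> \<in> space M. \<bar>Y (Suc n) \<omega> - 0\<bar> \<ge> \<epsilon>}) < \<infinity>" .
qed (use meas in auto)

theorem proposition3p8:
  fixes M :: "'a measure" and X :: "nat \<Rightarrow> 'a \<Rightarrow> real" and p :: real
  assumes "prob_space M"
    and "\<And>n. n \<ge> 1 \<Longrightarrow> X n \<in> borel_measurable M"
    and "1 < p"
    and "(\<Sum>n. Lp_norm M p (X (Suc n))) < \<infinity>"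
  shows "(\<forall>q. 1 < q \<and> q \<le> p \<longrightarrow>
            (\<Sum>n. \<integral>\<^sup>+ \<omega>. ennreal (\<bar>partial_sum X (Suc n) \<omega> / real (Suc n)\<bar> powr q) \<partial>M) < \<infinity>)
       \<and> converges_completely M (\<lambda>n \<omega>. partial_sum X n \<omega> / real n) (\<lambda>_. 0)"
proof -
  interpret prob_space M by fact
  have Lp_fin: "Lp_norm M p (X (Suc n)) < \<infinity>" for n
    using ennreal_suminf_lessD[of "\<lambda>n. Lp_norm M p (X (Suc n))" \<infinity>] assms(4) by blast
  \<comment> \<open>\<open>c\<close> starts at 0, so \<open>c n\<close> belongs to
    \<open>X (Suc n)\<close>; this is the reason for the shift \<open>k - 1\<close> below. The value
    of \<open>b\<close> at 0 never enters the sums.\<close>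
  define c where "c n = enn2real (Lp_norm M p (X (Suc n)))" for n
  have Lp_eq: "Lp_norm M p (X (Suc n)) = ennreal (c n)" for n
    using Lp_fin[of n] by (simp add: c_def)
  have summable_c: "summable c"
    using assms(4) by (intro summable_suminf_not_top) (auto simp: Lp_eq, simp add: c_def)
  \<comment> \<open>The geometric term makes \<open>b\<close> strictly positive even where \<open>X k\<close> vanishes almost everywhere.\<close>
  define b where "b k = c (k - 1) + (1/2) ^ (k - 1)" for k
  have c_nonneg: "c n \<ge> 0" for n
    by (simp add: c_def)
  have b_pos: "b k > 0" for k
    by (simp add: b_def c_nonneg add_nonneg_pos)
  have summable_b: "summable (\<lambda>n. b (Suc n))"
    using summable_c by (simp add: b_def summable_add)
  define B where "B = (\<Sum>n. b (Suc n))"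
  have sum_b_le: "sum b {1..n} \<le> B" for n
  proof -
    have "sum b {1..n} = (\<Sum>k<n. b (Suc k))"
      by (rule sum.reindex_bij_witness[of _ Suc "\<lambda>k. k - 1"]) auto
    also have "\<dots> \<le> B"
      unfolding B_def using summable_b b_pos by (intro sum_le_suminf) (auto simp: less_imp_le)
    finally show ?thesis .
  qed
  have moment: "(\<integral>\<^sup>+ \<omega>. ennreal (\<bar>X k \<omega>\<bar> powr p) \<partial>M) \<le> ennreal (b k powr p)" if k_in: "k \<in> {1..n}" for k n
  proof -
    obtain j where k: "k = Suc j"
      using k_in by (cases k) auto
    have "(\<integral>\<^sup>+ \<omega>. ennreal (\<bar>X k \<omega>\<bar> powr p) \<partial>M) = ennreal (c j powr p)"
      using nn_integral_powr_eq_Lp_norm[OF Lp_fin[of j]] assms(3) by (simp add: k c_def)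
    also have "\<dots> \<le> ennreal (b k powr p)"
      using assms(3) c_nonneg by (intro ennreal_leI powr_mono2) (auto simp: k b_def)
    finally show ?thesis .
  qed
  have moments_summable:
    "(\<Sum>n. \<integral>\<^sup>+ \<omega>. ennreal (\<bar>partial_sum X (Suc n) \<omega> / real (Suc n)\<bar> powr q) \<partial>M) < \<infinity>"
    if q: "1 < q" "q \<le> p" for q
  proof -
    let ?f = "\<lambda>n. 2 * B powr q * real (Suc n) powr - q"
    have "(\<integral>\<^sup>+ \<omega>. ennreal (\<bar>partial_sum X (Suc n) \<omega> / real (Suc n)\<bar> powr q) \<partial>M) \<le> ennreal (?f n)" for n
    proof -
      have "(\<lambda>\<omega>. \<Sum>k=1..Suc n. X k \<omega>) \<in> borel_measurable M"
        using assms(2) by (intro borel_measurable_sum) auto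
      then have [measurable]: "partial_sum X (Suc n) \<in> borel_measurable M"
        by (simp add: partial_sum_def[abs_def])
      have "(\<integral>\<^sup>+ \<omega>. ennreal (\<bar>partial_sum X (Suc n) \<omega> / real (Suc n)\<bar> powr q) \<partial>M)
          = (\<integral>\<^sup>+ \<omega>. ennreal (real (Suc n) powr - q) * ennreal (\<bar>partial_sum X (Suc n) \<omega>\<bar> powr q) \<partial>M)"
        by (intro nn_integral_cong)
          (simp add: abs_divide powr_divide powr_minus_divide flip: ennreal_mult)
      also have "\<dots> = ennreal (real (Suc n) powr - q)
          * (\<integral>\<^sup>+ \<omega>. ennreal (\<bar>partial_sum X (Suc n) \<omega>\<bar> powr q) \<partial>M)"
        by (rule nn_integral_cmult) measurable
      \<comment> \<open>The moments are controlled at exponent \<open>p\<close>, the sum is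
        estimated at exponent \<open>q\<close>; so one sequence \<open>b\<close> serves every
        \<open>q\<close> up to \<open>p\<close>.\<close>
      also have "\<dots> \<le> ennreal (real (Suc n) powr - q) * ennreal (2 * sum b {1..Suc n} powr q)"
        unfolding partial_sum_def using q assms(2) b_pos moment
        by (intro mult_left_mono nn_integral_abs_sum_powr_le[where p = p]) auto
      also have "\<dots> \<le> ennreal (real (Suc n) powr - q) * ennreal (2 * B powr q)"
        using q b_pos sum_b_le
        by (intro mult_left_mono ennreal_leI powr_mono2 sum_nonneg) (auto simp: less_imp_le simp del: sum.cl_ivl_Suc)
      also have "\<dots> = ennreal (?f n)"
        by (simp add: mult.commute flip: ennreal_mult)
      finally show ?thesis .
    qed
    then have "(\<Sum>n. \<integral>\<^sup>+ \<omega>. ennreal (\<bar>partial_sum X (Suc n) \<omega> / real (Suc n)\<bar> powr q) \<partial>M)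
        \<le> (\<Sum>n. ennreal (?f n))"
      by (intro suminf_le) auto
    also have "\<dots> < \<infinity>"
    proof -
      \<comment> \<open>Dropping the term at 0 does not affect summability, and the exponent
        \<open>- q\<close> lies below -1.\<close>
      have "summable (\<lambda>n. real (Suc n) powr - q)"
        using q summable_real_powr_iff[of "- q"]
        by (subst summable_Suc_iff[of "\<lambda>n. real n powr - q"]) simp
      then have "summable ?f"
        by (rule summable_mult)
      then have "(\<Sum>n. ennreal (?f n)) \<noteq> top"
        by (rule ennreal_suminf_neq_top) simp
      then show ?thesis
        by (simp add: top.not_eq_extremum)
    qed
    finally show ?thesis .
  qed
  moreover have "converges_completely M (\<lambda>n \<omega>. partial_sum X n \<omega> / real n) (\<lambda>_. 0)"
  proof (rule converges_completely_zeroI)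
    show "(\<lambda>\<omega>. partial_sum X n \<omega> / real n) \<in> borel_measurable M" if "n \<ge> 1" for n
      using assms(2) unfolding partial_sum_def by (intro borel_measurable_divide borel_measurable_sum) auto
    show "p > 0"
      using assms(3) by simp
    \<comment> \<open>A single exponent suffices for complete convergence; \<open>q = p\<close> is
      admissible because \<open>1 < p\<close>.\<close>
    show "(\<Sum>n. \<integral>\<^sup>+ \<omega>. ennreal (\<bar>partial_sum X (Suc n) \<omega> / real (Suc n)\<bar> powr p) \<partial>M) < \<infinity>"
      by (rule moments_summable) (use assms(3) in auto)
  qed
  ultimately show ?thesis by blast
qed

end
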